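(* Let $\Gamma$ be a countable set. Let $\{X_\gamma\}_{\gamma\in\Gamma}$ be a family of Banach spaces, each $X_\gamma$ equipped with a linear Hausdorff topology $\mathfrak{T}_\gamma$ coarser than the norm topology of $X_\gamma$, and let $\mathcal{E}$ be a Banach sequence space on $\Gamma$ equipped with a linear Hausdorff topology $\mathfrak{T}_{\mathcal{E}}$ coarser than the norm topology of $\mathcal{E}$. Let $\mathfrak{T}$ be a $\oplus$-compatible topology on $(\bigoplus_{\gamma\in\Gamma}X_\gamma)_{\mathcal{E}}$, and suppose that $(\bigoplus_{\gamma\in\Gamma}X_\gamma)_{\mathcal{E}}$ has the property $\mathbf{H}(\mathfrak{T})$. Then: (1) every $X_\gamma$ has the property $\mathbf{H}(\mathfrak{T}_\gamma)$ and $\mathcal{E}$ has the property $\mathbf{H}(\mathfrak{T}_{\mathcal{E}})$; (2) the set $\Gamma$ can be decomposed into two disjoint subsets $\Gamma_1$ and $\Gamma_2$ such that every $X_\gamma$ with $\gamma\in\Gamma_1$ has the Schur property with respect to $\mathfrak{T}_\gamma$ and $\mathcal{E}$ is $\mathbf{SM}(\gamma)$ for every $\gamma\in\Gamma_2$.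
   Context: Conventions: unless stated otherwise, Banach spaces are real and infinite-dimensional. "Coarser" is meant in the non-strict sense. A linear topology is a vector space topology. Banach sequence space on a countable set $\Gamma$: a Banach space $X$ that is a linear subspace of the space $\omega(\Gamma)$ of all real functions on $\Gamma$, contains the characteristic functions of all finite subsets of $\Gamma$, and has the ideal property: if $|x(\gamma)|\le|y(\gamma)|$ for all $\gamma\in\Gamma$ and $y\in X$, then $x\in X$ and $\|x\|\le\|y\|$. $X_+$ denotes the nonnegative elements of $X$; $\boldsymbol{e}_\gamma$ is the $\gamma$-th unit vector. Direct sum: $(\bigoplus_{\gamma\in\Gamma}X_\gamma)_{\mathcal{E}}$ is the Banach space of all $x=\{x(\gamma)\}_{\gamma\in\Gamma}\in\prod_{\gamma}X_\gamma$ with $\sum_{\gamma}\|x(\gamma)\|_{X_\gamma}\boldsymbol{e}_\gamma\in\mathcal{E}$, with coordinate-wise operations and norm $\|x\|=\big\|\sum_{\gamma}\|x(\gamma)\|_{X_\gamma}\boldsymbol{e}_\gamma\big\|_{\mathcal{E}}$. Maps: $\pi_\gamma(x)=x(\gamma)$ is the projection of the direct sum onto $X_\gamma$; $j_\gamma\colon X_\gamma\to(\bigoplus X_\gamma)_{\mathcal{E}}$ places a vector in the $\gamma$-th coordinate and $0$ elsewhere; $j_{\mathcal{E}}\colon\mathcal{E}\to(\bigoplus X_\gamma)_{\mathcal{E}}$ is $j_{\mathcal{E}}(a)=\{a(\gamma)x_\gamma\}_{\gamma\in\Gamma}$, where $\{x_\gamma\}_{\gamma\in\Gamma}$, $x_\gamma\in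 X_\gamma$, $\|x_\gamma\|=1$, is a sequence of norm-one vectors fixed once and for all. $\oplus$-compatible topology: a linear Hausdorff topology $\mathfrak{T}$ on $(\bigoplus X_\gamma)_{\mathcal{E}}$ is $\oplus$-compatible (with the $\mathfrak{T}_\gamma$ and $\mathfrak{T}_{\mathcal{E}}$) if (C1) $\mathfrak{T}$ is coarser than the norm topology; (C2) each $\pi_\gamma$ is $\mathfrak{T}$-to-$\mathfrak{T}_\gamma$ sequentially continuous; (C3) each $j_\gamma$ is $\mathfrak{T}_\gamma$-to-$\mathfrak{T}$ sequentially continuous; (C4) $j_{\mathcal{E}}$ is $\mathfrak{T}_{\mathcal{E}}$-to-$\mathfrak{T}$ sequentially continuous. Kadets--Klee property: for a linear Hausdorff topology $\mathfrak{T}$ on a Banach space $X$ coarser than the norm topology, $X$ has $\mathbf{H}(\mathfrak{T})$ if whenever $x_n,x$ lie on the unit sphere of $X$ and $x_n\to x$ in $\mathfrak{T}$, then $\|x_n-x\|\to0$. Equivalently: $x_n\to x$ in $\mathfrak{T}$ and $\|x_n\|\to\|x\|$ imply $\|x_n-x\|\to0$. Schur property with respect to $\mathfrak{T}$: every sequence in $X$ converging to some $x\in X$ in $\mathfrak{T}$ converges to $x$ in norm. $\mathbf{SM}(\gamma_0)$: a Banach sequence space $X$ on $\Gamma$ is $\mathbf{SM}(\gamma_0)$ if for all $x,y\in X_+$ with $x(\gamma)\le y(\gamma)$ for $\gamma\ne\gamma_0$ and $x(\gamma_0)<y(\gamma_0)$ one has $\|x\|<\|y\|$. *)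

theory Defs
  imports "HOL-Analysis.Analysis" "HOL-Library.Function_Algebras"
begin

instantiation "fun" :: (type, real_vector) real_vector
begin

definition scaleR_fun :: "real \<Rightarrow> ('a \<Rightarrow> 'b) \<Rightarrow> 'a \<Rightarrow> 'b"
  where "scaleR_fun c f = (\<lambda>x. c *\<^sub>R f x)"

instance
  by standard (auto simp: scaleR_fun_def fun_eq_iff scaleR_add_right scaleR_add_left)

end

text \<open>
  A normed space is a linear subspace \<open>V\<close> of some real vector space together with a norm \<open>N\<close>
  on \<open>V\<close>; the ambient space carries no norm, and the values of \<open>N\<close> outside \<open>V\<close> are irrelevant.
  A family of such spaces inside one ambient space, each with its own norm, represents an arbitrary
  family of normed spaces: take the algebraic direct sum as ambient space.
\<close>

locale normed_on =
  fixes V :: "'v::real_vector set" and N :: "'v \<Rightarrow> real"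
  assumes subspace_carrier: "subspace V"
    and norm_nonneg: "x \<in> V \<Longrightarrow> 0 \<le> N x"
    and norm_eq_zero_iff: "x \<in> V \<Longrightarrow> N x = 0 \<longleftrightarrow> x = 0"
    and norm_triangle: "x \<in> V \<Longrightarrow> y \<in> V \<Longrightarrow> N (x + y) \<le> N x + N y"
    and norm_scaleR: "x \<in> V \<Longrightarrow> N (c *\<^sub>R x) = \<bar>c\<bar> * N x"

text \<open>
  The locale \<open>Metric_space\<close> requires nonnegativity and symmetry on the whole type, hence the
  default value outside the carrier.
\<close>

definition norm_dist :: "'v::real_vector set \<Rightarrow> ('v \<Rightarrow> real) \<Rightarrow> 'v \<Rightarrow> 'v \<Rightarrow> real"
  where "norm_dist V N x y = (if x \<in> V \<and> y \<in> V then N (x - y) else 0)"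

lemma (in normed_on) Metric_space_norm_dist: "Metric_space V (norm_dist V N)"
proof
  fix x y z
  show "0 \<le> norm_dist V N x y"
    by (simp add: norm_dist_def norm_nonneg subspace_diff subspace_carrier)
  show "norm_dist V N x y = norm_dist V N y x"
    using norm_scaleR[of "x - y" "-1"] by (simp add: norm_dist_def subspace_diff subspace_carrier)
  show "norm_dist V N x y = 0 \<longleftrightarrow> x = y" if "x \<in> V" "y \<in> V"
    using that by (simp add: norm_dist_def norm_eq_zero_iff subspace_diff subspace_carrier)
  show "norm_dist V N x z \<le> norm_dist V N x y + norm_dist V N y z"
    if "x \<in> V" "y \<in> V" "z \<in> V"
    using that norm_triangle[of "x - y" "y - z"]
    by (simp add: norm_dist_def subspace_diff subspace_carrier)
qed

definition norm_topology :: "'v::real_vector set \<Rightarrow> ('v \<Rightarrow> real) \<Rightarrow> 'v topology"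
  where "norm_topology V N = Metric_space.mtopology V (norm_dist V N)"

locale banach_on = normed_on +
  assumes complete: "Metric_space.mcomplete V (norm_dist V N)"

definition infinite_dimensional :: "'v::real_vector set \<Rightarrow> bool"
  where "infinite_dimensional V \<longleftrightarrow> \<not> (\<exists>B. finite B \<and> V \<subseteq> span B)"

definition linear_topology_on :: "'v::real_vector set \<Rightarrow> 'v topology \<Rightarrow> bool"
  where "linear_topology_on V T \<longleftrightarrow>
    topspace T = V \<and>
    continuous_map (prod_topology T T) T (\<lambda>(x, y). x + y) \<and>
    continuous_map (prod_topology euclideanreal T) T (\<lambda>(c, x). c *\<^sub>R x)"

definition coarser_topology :: "'v topology \<Rightarrow> 'v topology \<Rightarrow> bool"
  where "coarser_topology S T \<longleftrightarrow>
    topspace S = topspace T \<and> (\<forall>U. openin S U \<longrightarrow> openin T U)"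

definition seq_continuous_map :: "'v topology \<Rightarrow> 'w topology \<Rightarrow> ('v \<Rightarrow> 'w) \<Rightarrow> bool"
  where "seq_continuous_map S T f \<longleftrightarrow>
    (\<forall>x\<in>topspace S. f x \<in> topspace T) \<and>
    (\<forall>s x. range s \<subseteq> topspace S \<and> limitin S s x sequentially \<longrightarrow>
      limitin T (\<lambda>n. f (s n)) (f x) sequentially)"

definition Kadets_Klee :: "'v::real_vector set \<Rightarrow> ('v \<Rightarrow> real) \<Rightarrow> 'v topology \<Rightarrow> bool"
  where "Kadets_Klee V N T \<longleftrightarrow>
    (\<forall>s x. (\<forall>n. s n \<in> V \<and> N (s n) = 1) \<and> x \<in> V \<and> N x = 1 \<and> limitin T s x sequentially
      \<longrightarrow> (\<lambda>n. N (s n - x)) \<longlonglongrightarrow> 0)"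

definition Schur_property :: "'v::real_vector set \<Rightarrow> ('v \<Rightarrow> real) \<Rightarrow> 'v topology \<Rightarrow> bool"
  where "Schur_property V N T \<longleftrightarrow>
    (\<forall>s x. (\<forall>n. s n \<in> V) \<and> x \<in> V \<and> limitin T s x sequentially
      \<longrightarrow> (\<lambda>n. N (s n - x)) \<longlonglongrightarrow> 0)"

text \<open>
  The countable index set is the universe of the type \<open>'g\<close>, so that the space of all real functions
  on it is the whole type \<^typ>\<open>'g \<Rightarrow> real\<close>. Finite index sets are allowed.
\<close>

locale banach_sequence_space = banach_on E N
  for E :: "('g::countable \<Rightarrow> real) set" and N :: "('g \<Rightarrow> real) \<Rightarrow> real" +
  assumes indicator_mem: "finite A \<Longrightarrow> indicator A \<in> E"
    and ideal_mem: "y \<in> E \<Longrightarrow> (\<And>\<gamma>. \<bar>x \<gamma>\<bar> \<le> \<bar>y \<gamma>\<bar>) \<Longrightarrow> x \<in> E"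
    and ideal_norm: "y \<in> E \<Longrightarrow> (\<And>\<gamma>. \<bar>x \<gamma>\<bar> \<le> \<bar>y \<gamma>\<bar>) \<Longrightarrow> N x \<le> N y"

definition SM :: "('g \<Rightarrow> real) set \<Rightarrow> (('g \<Rightarrow> real) \<Rightarrow> real) \<Rightarrow> 'g \<Rightarrow> bool"
  where "SM E N \<gamma>0 \<longleftrightarrow>
    (\<forall>x\<in>E. \<forall>y\<in>E. (\<forall>\<gamma>. 0 \<le> x \<gamma>) \<and> (\<forall>\<gamma>. 0 \<le> y \<gamma>) \<and>
      (\<forall>\<gamma>. \<gamma> \<noteq> \<gamma>0 \<longrightarrow> x \<gamma> \<le> y \<gamma>) \<and> x \<gamma>0 < y \<gamma>0 \<longrightarrow> N x < N y)"

definition direct_sum ::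
  "('g \<Rightarrow> 'v set) \<Rightarrow> ('g \<Rightarrow> 'v \<Rightarrow> real) \<Rightarrow> ('g \<Rightarrow> real) set \<Rightarrow> ('g \<Rightarrow> 'v) set"
  where "direct_sum X NX E = {x. (\<forall>\<gamma>. x \<gamma> \<in> X \<gamma>) \<and> (\<lambda>\<gamma>. NX \<gamma> (x \<gamma>)) \<in> E}"

definition direct_sum_norm ::
  "('g \<Rightarrow> 'v \<Rightarrow> real) \<Rightarrow> (('g \<Rightarrow> real) \<Rightarrow> real) \<Rightarrow> ('g \<Rightarrow> 'v) \<Rightarrow> real"
  where "direct_sum_norm NX NE x = NE (\<lambda>\<gamma>. NX \<gamma> (x \<gamma>))"

lemma normed_on_direct_sum:
  assumes X: "\<And>\<gamma>. normed_on (X \<gamma>) (NX \<gamma>)" and E: "banach_sequence_space E NE"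
  shows "normed_on (direct_sum X NX E) (direct_sum_norm NX NE)"
proof -
  interpret E: banach_sequence_space E NE by fact
  interpret X: normed_on "X \<gamma>" "NX \<gamma>" for \<gamma> by (rule X)
  note sub = X.subspace_carrier E.subspace_carrier
  have scale_eq: "(\<lambda>\<gamma>. NX \<gamma> ((c *\<^sub>R x) \<gamma>)) = \<bar>c\<bar> *\<^sub>R (\<lambda>\<gamma>. NX \<gamma> (x \<gamma>))"
    if "x \<in> direct_sum X NX E" for c x
    using that by (simp add: direct_sum_def scaleR_fun_def X.norm_scaleR)
  have add_le: "\<bar>NX \<gamma> ((x + y) \<gamma>)\<bar> \<le> \<bar>((\<lambda>\<gamma>. NX \<gamma> (x \<gamma>)) + (\<lambda>\<gamma>. NX \<gamma> (y \<gamma>))) \<gamma>\<bar>"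
    if "x \<in> direct_sum X NX E" "y \<in> direct_sum X NX E" for x y \<gamma>
    using that X.norm_triangle[of "x \<gamma>" \<gamma> "y \<gamma>"] X.norm_nonneg[of "x \<gamma> + y \<gamma>" \<gamma>]
    by (simp add: direct_sum_def subspace_add[OF X.subspace_carrier])
  have sum_mem: "(\<lambda>\<gamma>. NX \<gamma> (x \<gamma>)) + (\<lambda>\<gamma>. NX \<gamma> (y \<gamma>)) \<in> E"
    if "x \<in> direct_sum X NX E" "y \<in> direct_sum X NX E" for x y
    using that by (simp add: direct_sum_def subspace_add[OF E.subspace_carrier])
  have zero: "NX \<gamma> 0 = 0" for \<gamma>
    using X.norm_eq_zero_iff[of 0 \<gamma>] subspace_0[OF X.subspace_carrier] by simp
  show ?thesis
  proof
    show "subspace (direct_sum X NX E)"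
    proof (rule subspaceI)
      have "(\<lambda>\<gamma>::'a. 0::real) \<in> E"
        using subspace_0[OF E.subspace_carrier] by (simp add: zero_fun_def)
      then show "0 \<in> direct_sum X NX E"
        by (simp add: direct_sum_def zero subspace_0[OF X.subspace_carrier])
    next
      fix x y assume xy: "x \<in> direct_sum X NX E" "y \<in> direct_sum X NX E"
      have "(\<lambda>\<gamma>. NX \<gamma> ((x + y) \<gamma>)) \<in> E"
        using E.ideal_mem[OF sum_mem[OF xy] add_le[OF xy]] .
      with xy show "x + y \<in> direct_sum X NX E"
        by (auto simp: direct_sum_def subspace_add[OF X.subspace_carrier])
    next
      fix c x assume x: "x \<in> direct_sum X NX E"
      have "(\<lambda>\<gamma>. NX \<gamma> ((c *\<^sub>R x) \<gamma>)) \<in> E"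
        unfolding scale_eq[OF x] using x
        by (simp add: direct_sum_def subspace_scale[OF E.subspace_carrier])
      with x show "c *\<^sub>R x \<in> direct_sum X NX E"
        by (auto simp: direct_sum_def scaleR_fun_def subspace_scale[OF X.subspace_carrier])
    qed
  next
    fix x assume x: "x \<in> direct_sum X NX E"
    then show "0 \<le> direct_sum_norm NX NE x"
      by (simp add: direct_sum_def direct_sum_norm_def E.norm_nonneg)
    show "direct_sum_norm NX NE x = 0 \<longleftrightarrow> x = 0"
      using x by (simp add: direct_sum_def direct_sum_norm_def E.norm_eq_zero_iff fun_eq_iff X.norm_eq_zero_iff)
    show "direct_sum_norm NX NE (c *\<^sub>R x) = \<bar>c\<bar> * direct_sum_norm NX NE x" for c
      unfolding direct_sum_norm_def scale_eq[OF x] using x by (simp add: direct_sum_def E.norm_scaleR)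
    fix y assume y: "y \<in> direct_sum X NX E"
    have "direct_sum_norm NX NE (x + y) \<le> NE ((\<lambda>\<gamma>. NX \<gamma> (x \<gamma>)) + (\<lambda>\<gamma>. NX \<gamma> (y \<gamma>)))"
      unfolding direct_sum_norm_def by (rule E.ideal_norm[OF sum_mem[OF x y] add_le[OF x y]])
    also have "\<dots> \<le> direct_sum_norm NX NE x + direct_sum_norm NX NE y"
      using x y by (simp add: direct_sum_def direct_sum_norm_def E.norm_triangle)
    finally show "direct_sum_norm NX NE (x + y) \<le> direct_sum_norm NX NE x + direct_sum_norm NX NE y" .
  qed
qed

definition direct_sum_proj :: "'g \<Rightarrow> ('g \<Rightarrow> 'v) \<Rightarrow> 'v"
  where "direct_sum_proj \<gamma> x = x \<gamma>"

definition direct_sum_inj :: "'g \<Rightarrow> 'v::zero \<Rightarrow> 'g \<Rightarrow> 'v"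
  where "direct_sum_inj \<gamma> v = (\<lambda>\<delta>. if \<delta> = \<gamma> then v else 0)"

definition seq_inj :: "('g \<Rightarrow> 'v::real_vector) \<Rightarrow> ('g \<Rightarrow> real) \<Rightarrow> 'g \<Rightarrow> 'v"
  where "seq_inj u a = (\<lambda>\<gamma>. a \<gamma> *\<^sub>R u \<gamma>)"

definition direct_sum_compatible ::
  "('g::countable \<Rightarrow> 'v::real_vector set) \<Rightarrow> ('g \<Rightarrow> 'v \<Rightarrow> real) \<Rightarrow> ('g \<Rightarrow> 'v topology) \<Rightarrow>
   ('g \<Rightarrow> real) set \<Rightarrow> (('g \<Rightarrow> real) \<Rightarrow> real) \<Rightarrow> ('g \<Rightarrow> real) topology \<Rightarrow>
   ('g \<Rightarrow> 'v) \<Rightarrow> ('g \<Rightarrow> 'v) topology \<Rightarrow> bool"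
  where "direct_sum_compatible X NX TX E NE TE u T \<longleftrightarrow>
    linear_topology_on (direct_sum X NX E) T \<and> Hausdorff_space T \<and>
    coarser_topology T (norm_topology (direct_sum X NX E) (direct_sum_norm NX NE)) \<and>
    (\<forall>\<gamma>. seq_continuous_map T (TX \<gamma>) (direct_sum_proj \<gamma>)) \<and>
    (\<forall>\<gamma>. seq_continuous_map (TX \<gamma>) T (direct_sum_inj \<gamma>)) \<and>
    seq_continuous_map TE T (seq_inj u)"

end

theory Submission
  imports Defs
begin

text \<open>
  Each summand and the sequence space embed into the direct sum, the first up to a constant factor
  and the second isometrically, and both embeddings are sequentially continuous, so they transfer the
  Kadets--Klee property from the direct sum. Where vectors of norm other than one occur, the property
  is used in its homogeneous form \<open>Kadets_Klee_tendsto\<close>, which asks for convergence of the norms.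

  For the decomposition, let \<open>\<Gamma>2\<close> consist of all \<open>\<gamma>\<close> for which the norm of the sequence space is
  \<^const>\<open>SM\<close>. If \<open>\<gamma>\<close> is not among them, then by convexity (\<open>not_SM_imp_flat\<close>) there are a
  nonnegative sequence \<open>a\<close> with \<open>a \<gamma> = 0\<close> and some \<open>r > 0\<close> such that raising \<open>a \<gamma>\<close> to any value
  up to \<open>r\<close> leaves the norm unchanged. Now shorten the vectors of a sequence that tends to zero in
  the topology of \<open>X \<gamma>\<close> to length at most \<open>r\<close> and insert them at \<open>\<gamma>\<close> into the image of \<open>a\<close> in the
  direct sum. The resulting vectors converge to the image of \<open>a\<close> and all have its norm, so they
  converge in norm, and hence so does the given sequence (\<open>Schur_property_summand\<close>).
\<close>

section \<open>Limits in linear topologies\<close>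

lemma linear_topology_limitin_add:
  assumes T: "linear_topology_on V T"
    and s: "limitin T s x F" and t: "limitin T t y F"
  shows "limitin T (\<lambda>n. s n + t n) (x + y) F"
proof -
  have "limitin (prod_topology T T) (\<lambda>n. (s n, t n)) (x, y) F"
    using s t by (simp add: limitin_pairwise o_def)
  moreover have "continuous_map (prod_topology T T) T (\<lambda>(x, y). x + y)"
    using T by (simp add: linear_topology_on_def)
  ultimately show ?thesis
    by (auto dest!: continuous_map_limit simp: o_def)
qed

lemma linear_topology_limitin_scaleR:
  assumes T: "linear_topology_on V T"
    and c: "(c \<longlongrightarrow> l) F" and s: "limitin T s x F"
  shows "limitin T (\<lambda>n. c n *\<^sub>R s n) (l *\<^sub>R x) F"
proof -
  have "limitin (prod_topology euclideanreal T) (\<lambda>n. (c n, s n)) (l, x) F"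
    using c s by (simp add: limitin_pairwise o_def)
  moreover have "continuous_map (prod_topology euclideanreal T) T (\<lambda>(c, x). c *\<^sub>R x)"
    using T by (simp add: linear_topology_on_def)
  ultimately show ?thesis
    by (auto dest!: continuous_map_limit simp: o_def)
qed

lemma linear_topology_limitin_const:
  assumes "linear_topology_on V T" "x \<in> V"
  shows "limitin T (\<lambda>n. x) x F"
  using assms unfolding linear_topology_on_def limitin_def by simp

text \<open>
  The scalars need not converge. Continuity of scalar multiplication at \<open>(0, 0)\<close> puts all products
  of a scalar below some \<open>d\<close> with a vector of some neighbourhood \<open>W\<close> of zero into a given
  neighbourhood of zero, and the bound on the scalars can be shifted to the vectors, whose fixed
  multiples also tend to zero and hence enter \<open>W\<close>.
\<close>

lemma linear_topology_limitin_bounded_scaleR_zero: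
  assumes T: "linear_topology_on V T"
    and c: "\<And>n. \<bar>c n\<bar> \<le> K" and s: "limitin T s 0 F"
  shows "limitin T (\<lambda>n. c n *\<^sub>R s n) 0 F"
  unfolding limitin_def
proof (intro conjI allI impI)
  show zero: "0 \<in> topspace T"
    using s by (simp add: limitin_def)
  fix U assume U: "openin T U \<and> 0 \<in> U"
  let ?P = "prod_topology euclideanreal T"
  have "continuous_map ?P T (\<lambda>(c, x). c *\<^sub>R x)"
    using T by (simp add: linear_topology_on_def)
  then have "openin ?P {p \<in> topspace ?P. (\<lambda>(c, x). c *\<^sub>R x) p \<in> U}"
    using U by (simp only: openin_continuous_map_preimage)
  moreover have "(0, 0) \<in> {p \<in> topspace ?P. (\<lambda>(c, x). c *\<^sub>R x) p \<in> U}"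
    using zero U by simp
  ultimately obtain D W where D: "openin euclideanreal D" "0 \<in> D" and W: "openin T W" "0 \<in> W"
    and DW: "D \<times> W \<subseteq> {p \<in> topspace ?P. (\<lambda>(c, x). c *\<^sub>R x) p \<in> U}"
    unfolding openin_prod_topology_alt by blast
  obtain d where d: "0 < d" "\<And>a. \<bar>a\<bar> < d \<Longrightarrow> a \<in> D"
    using D open_dist[THEN iffD1, of D] open_openin[THEN iffD2, of D]
    by (force simp: dist_real_def)
  define k where "k = (\<bar>K\<bar> + 1) / d"
  have k: "0 < k"
    using d by (simp add: k_def)
  have "limitin T (\<lambda>n. k *\<^sub>R s n) 0 F"
    using linear_topology_limitin_scaleR[OF T tendsto_const s, of k] by simp
  then have "\<forall>\<^sub>F n in F. k *\<^sub>R s n \<in> W"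
    using W by (auto simp: limitin_def)
  then show "\<forall>\<^sub>F n in F. c n *\<^sub>R s n \<in> U"
  proof eventually_elim
    case (elim n)
    have "\<bar>c n\<bar> < \<bar>K\<bar> + 1"
      using c[of n] by linarith
    then have "\<bar>c n\<bar> < d * k"
      using d by (simp add: k_def)
    then have "\<bar>c n / k\<bar> < d"
      using k by (simp add: pos_divide_less_eq)
    then have "(c n / k, k *\<^sub>R s n) \<in> D \<times> W"
      using d elim by simp
    then have "(c n / k) *\<^sub>R (k *\<^sub>R s n) \<in> U"
      using DW by fastforce
    then show ?case
      using k by simp
  qed
qed

section \<open>The Kadets--Klee property off the unit sphere\<close>

text \<open>
  Unless the limit is zero, where the claim is about norms only, both the sequence and its limit can
  be normalized: the norms converge to a nonzero number, so this preserves the convergence.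
\<close>

lemma Kadets_Klee_tendsto:
  assumes V: "normed_on V N" and T: "linear_topology_on V T" and KK: "Kadets_Klee V N T"
    and s: "\<And>n. s n \<in> V" and x: "x \<in> V"
    and lim: "limitin T s x sequentially" and norms: "(\<lambda>n. N (s n)) \<longlonglongrightarrow> N x"
  shows "(\<lambda>n. N (s n - x)) \<longlonglongrightarrow> 0"
proof (cases "N x = 0")
  case True
  then have "x = 0"
    using normed_on.norm_eq_zero_iff[OF V x] by simp
  then show ?thesis
    using norms True by simp
next
  case False
  interpret normed_on V N by fact
  note mem = subspace_scale[OF subspace_carrier] subspace_diff[OF subspace_carrier]
  have pos: "0 < N x"
    using False norm_nonneg[OF x] by simp
  define x' where "x' = (1 / N x) *\<^sub>R x"
  have x': "x' \<in> V" "N x' = 1"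
    using x pos by (simp_all add: x'_def mem norm_scaleR)
  \<comment> \<open>Finitely many terms may be zero; they are replaced by the limit.\<close>
  define y where "y n = (if N (s n) = 0 then x' else (1 / N (s n)) *\<^sub>R s n)" for n
  have y: "y n \<in> V" "N (y n) = 1" for n
    using s[of n] x' norm_nonneg[OF s[of n]] by (auto simp: y_def mem norm_scaleR)
  have nonzero: "\<forall>\<^sub>F n in sequentially. N (s n) \<noteq> 0"
    using tendsto_imp_eventually_ne[OF norms False] .
  have "limitin T (\<lambda>n. (1 / N (s n)) *\<^sub>R s n) x' sequentially"
    unfolding x'_def using norms False
    by (intro linear_topology_limitin_scaleR[OF T _ lim] tendsto_intros)
  then have "limitin T y x' sequentially"
    by (rule limitin_transform_eventually[rotated])
      (use nonzero in eventually_elim, simp add: y_def)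
  then have "(\<lambda>n. N (y n - x')) \<longlonglongrightarrow> 0"
    using KK y x' unfolding Kadets_Klee_def by blast
  then have bound: "(\<lambda>n. N (s n) * N (y n - x') + \<bar>N (s n) / N x - 1\<bar> * N x) \<longlonglongrightarrow> 0"
    by (rule tendsto_eq_rhs[OF tendsto_add[OF tendsto_mult[OF norms]
          tendsto_mult[OF tendsto_rabs[OF tendsto_diff[OF tendsto_divide[OF norms tendsto_const]
          tendsto_const]] tendsto_const]]]) (use False in simp_all)
  show ?thesis
  proof (rule tendsto_sandwich[OF _ _ tendsto_const bound])
    show "\<forall>\<^sub>F n in sequentially. 0 \<le> N (s n - x)"
      using norm_nonneg s x by (simp add: mem)
    show "\<forall>\<^sub>F n in sequentially.
        N (s n - x) \<le> N (s n) * N (y n - x') + \<bar>N (s n) / N x - 1\<bar> * N x"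
      using nonzero
    proof eventually_elim
      case (elim n)
      have eq: "s n - x = N (s n) *\<^sub>R (y n - x') + (N (s n) / N x - 1) *\<^sub>R x"
        using elim by (simp add: y_def x'_def algebra_simps)
      have "N (s n - x) \<le> N (N (s n) *\<^sub>R (y n - x')) + N ((N (s n) / N x - 1) *\<^sub>R x)"
        unfolding eq using x x' y by (intro norm_triangle mem)
      then show ?case
        using x x' y s[of n] by (simp add: norm_scaleR mem norm_nonneg)
    qed
  qed
qed

section \<open>Coordinates along which the norm of a sequence space is flat\<close>

lemma (in banach_sequence_space) norm_abs:
  "x \<in> E \<Longrightarrow> (\<lambda>\<gamma>. \<bar>x \<gamma>\<bar>) \<in> E \<and> N (\<lambda>\<gamma>. \<bar>x \<gamma>\<bar>) = N x"
  using ideal_mem[of x "\<lambda>\<gamma>. \<bar>x \<gamma>\<bar>"] ideal_norm[of x "\<lambda>\<gamma>. \<bar>x \<gamma>\<bar>"]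
    ideal_norm[of "\<lambda>\<gamma>. \<bar>x \<gamma>\<bar>" x] by force

lemma (in banach_sequence_space) norm_unit_pos: "0 < N (indicator {\<gamma>})"
proof -
  have "indicator {\<gamma>} \<in> E"
    by (simp add: indicator_mem)
  moreover have "indicator {\<gamma>} \<noteq> 0"
    by (auto simp: fun_eq_iff indicator_def)
  ultimately show ?thesis
    using norm_nonneg norm_eq_zero_iff by (metis order_le_less)
qed

text \<open>
  As a function of the value in one coordinate the norm is convex, even, and nondecreasing on the
  nonnegative half-line. If \<^const>\<open>SM\<close> fails, it takes the same value at two points
  \<open>0 \<le> x \<gamma> < y \<gamma>\<close>; convexity then forces it to be constant all the way down to zero. That the flat
  part contains zero is what makes the failure usable: the coordinate can be perturbed around
  zero in any direction without changing the norm.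
\<close>

lemma (in banach_sequence_space) not_SM_imp_flat:
  assumes "\<not> SM E N \<gamma>"
  obtains a r where "a \<in> E" "\<And>\<delta>. 0 \<le> a \<delta>" "a \<gamma> = 0" "0 < r"
    "\<And>t. 0 \<le> t \<Longrightarrow> t \<le> r \<Longrightarrow> a(\<gamma> := t) \<in> E \<and> N (a(\<gamma> := t)) = N a"
proof -
  obtain x y where x: "x \<in> E" "\<And>\<delta>. 0 \<le> x \<delta>" and y: "y \<in> E" "\<And>\<delta>. 0 \<le> y \<delta>"
    and le: "\<And>\<delta>. \<delta> \<noteq> \<gamma> \<Longrightarrow> x \<delta> \<le> y \<delta>" and less: "x \<gamma> < y \<gamma>" and N: "N y \<le> N x"
    using assms unfolding SM_def by (auto simp: not_less)
  define a where "a = x(\<gamma> := 0)"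
  define b where "b = x(\<gamma> := y \<gamma>)"
  have a: "a \<in> E"
    by (rule ideal_mem[OF x(1)]) (simp add: a_def)
  have le_y: "\<bar>b \<delta>\<bar> \<le> \<bar>y \<delta>\<bar>" for \<delta>
    using le x y by (simp add: b_def)
  have b: "b \<in> E" "N b \<le> N y"
    using ideal_mem[OF y(1) le_y] ideal_norm[OF y(1) le_y] by auto
  define l where "l = x \<gamma> / y \<gamma>"
  have ypos: "0 < y \<gamma>"
    using less x(2)[of \<gamma>] by linarith
  have l: "0 \<le> l" "l < 1"
    using less x(2)[of \<gamma>] ypos by (simp_all add: l_def)
  have conv: "x = (1 - l) *\<^sub>R a + l *\<^sub>R b"
    using ypos by (auto simp: fun_eq_iff scaleR_fun_def a_def b_def l_def algebra_simps)
  have "N x \<le> N ((1 - l) *\<^sub>R a) + N (l *\<^sub>R b)"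
    by (subst conv) (intro norm_triangle subspace_scale subspace_carrier a b)
  also have "\<dots> = (1 - l) * N a + l * N b"
    using a b l by (simp add: norm_scaleR)
  also have "\<dots> \<le> (1 - l) * N a + l * N x"
    using b N l by (intro add_left_mono mult_left_mono) auto
  finally have "(1 - l) * N x \<le> (1 - l) * N a"
    by (simp add: algebra_simps)
  then have "N x \<le> N a"
    using l by simp
  then have ba: "N b \<le> N a"
    using b N by linarith
  have flat: "a(\<gamma> := t) \<in> E \<and> N (a(\<gamma> := t)) = N a" if t: "0 \<le> t" "t \<le> y \<gamma>" for t
  proof -
    have up: "\<bar>(a(\<gamma> := t)) \<delta>\<bar> \<le> \<bar>b \<delta>\<bar>" for \<delta>
      using t by (simp add: a_def b_def)
    have down: "\<bar>a \<delta>\<bar> \<le> \<bar>(a(\<gamma> := t)) \<delta>\<bar>" for \<delta>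
      by (simp add: a_def)
    have mem: "a(\<gamma> := t) \<in> E"
      using ideal_mem[OF b(1) up] .
    have "N (a(\<gamma> := t)) \<le> N a"
      using ideal_norm[OF b(1) up] ba by (rule order_trans)
    moreover have "N a \<le> N (a(\<gamma> := t))"
      using ideal_norm[OF mem down] .
    ultimately have "N (a(\<gamma> := t)) = N a"
      by (rule order_antisym)
    with mem show ?thesis ..
  qed
  have "0 \<le> a \<delta>" for \<delta>
    by (simp add: a_def x)
  moreover have "a \<gamma> = 0"
    by (simp add: a_def)
  ultimately show thesis
    by (rule that[OF a _ _ ypos flat])
qed

section \<open>Embeddings into the direct sum\<close>

lemma direct_sum_inj_mem_norm:
  assumes X: "\<And>\<gamma>. normed_on (X \<gamma>) (NX \<gamma>)" and E: "banach_sequence_space E NE"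
    and v: "v \<in> X \<gamma>"
  shows "direct_sum_inj \<gamma> v \<in> direct_sum X NX E"
    and "direct_sum_norm NX NE (direct_sum_inj \<gamma> v) = NX \<gamma> v * NE (indicator {\<gamma>})"
proof -
  interpret E: banach_sequence_space E NE by fact
  interpret X: normed_on "X \<delta>" "NX \<delta>" for \<delta> by (rule X)
  have zero: "0 \<in> X \<delta>" "NX \<delta> 0 = 0" for \<delta>
    using X.norm_eq_zero_iff[of 0 \<delta>] subspace_0[OF X.subspace_carrier] by simp_all
  have eq: "(\<lambda>\<delta>. NX \<delta> (direct_sum_inj \<gamma> v \<delta>)) = NX \<gamma> v *\<^sub>R indicator {\<gamma>}"
    by (auto simp: fun_eq_iff scaleR_fun_def direct_sum_inj_def zero indicator_def)
  have unit: "indicator {\<gamma>} \<in> E"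
    by (simp add: E.indicator_mem)
  show "direct_sum_inj \<gamma> v \<in> direct_sum X NX E"
    using v unit unfolding direct_sum_def mem_Collect_eq eq
    by (auto simp: direct_sum_inj_def zero subspace_scale E.subspace_carrier)
  show "direct_sum_norm NX NE (direct_sum_inj \<gamma> v) = NX \<gamma> v * NE (indicator {\<gamma>})"
    using v unit unfolding direct_sum_norm_def eq by (simp add: E.norm_scaleR X.norm_nonneg)
qed

lemma seq_inj_mem_norm:
  assumes X: "\<And>\<gamma>. normed_on (X \<gamma>) (NX \<gamma>)" and E: "banach_sequence_space E NE"
    and u: "\<And>\<gamma>. u \<gamma> \<in> X \<gamma> \<and> NX \<gamma> (u \<gamma>) = 1" and a: "a \<in> E"
  shows "seq_inj u a \<in> direct_sum X NX E"
    and "direct_sum_norm NX NE (seq_inj u a) = NE a"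
proof -
  interpret E: banach_sequence_space E NE by fact
  interpret X: normed_on "X \<delta>" "NX \<delta>" for \<delta> by (rule X)
  have eq: "(\<lambda>\<gamma>. NX \<gamma> (seq_inj u a \<gamma>)) = (\<lambda>\<gamma>. \<bar>a \<gamma>\<bar>)"
    using u by (simp add: seq_inj_def X.norm_scaleR)
  show "seq_inj u a \<in> direct_sum X NX E"
    using u E.norm_abs[OF a] unfolding direct_sum_def mem_Collect_eq eq
    by (auto simp: seq_inj_def subspace_scale X.subspace_carrier)
  show "direct_sum_norm NX NE (seq_inj u a) = NE a"
    using E.norm_abs[OF a] unfolding direct_sum_norm_def eq by simp
qed

lemma direct_sum_inj_diff:
  "direct_sum_inj \<gamma> (v - w) = direct_sum_inj \<gamma> v - (direct_sum_inj \<gamma> w :: _ \<Rightarrow> 'v::real_vector)"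
  by (auto simp: direct_sum_inj_def fun_eq_iff)

lemma seq_inj_diff: "seq_inj u (a - b) = seq_inj u a - seq_inj u b"
  by (auto simp: seq_inj_def fun_eq_iff algebra_simps)

section \<open>Consequences of the Kadets--Klee property of the direct sum\<close>

text \<open>
  The embedding multiplies norms by the norm of the unit vector \<open>indicator {\<gamma>}\<close>, which need not be
  one, so unit vectors do not go to unit vectors and \<open>Kadets_Klee_tendsto\<close> is needed.
\<close>

lemma Kadets_Klee_summand:
  assumes X: "\<And>\<gamma>. normed_on (X \<gamma>) (NX \<gamma>)" and E: "banach_sequence_space E NE"
    and TX: "topspace (TX \<gamma>) = X \<gamma>"
    and T: "linear_topology_on (direct_sum X NX E) T"
    and inj: "seq_continuous_map (TX \<gamma>) T (direct_sum_inj \<gamma>)"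
    and KK: "Kadets_Klee (direct_sum X NX E) (direct_sum_norm NX NE) T"
  shows "Kadets_Klee (X \<gamma>) (NX \<gamma>) (TX \<gamma>)"
  unfolding Kadets_Klee_def
proof (intro allI impI, elim conjE)
  fix s x
  assume s: "\<forall>n. s n \<in> X \<gamma> \<and> NX \<gamma> (s n) = 1" and x: "x \<in> X \<gamma>" "NX \<gamma> x = 1"
    and lim: "limitin (TX \<gamma>) s x sequentially"
  let ?N = "direct_sum_norm NX NE" and ?c = "NE (indicator {\<gamma>})"
  note j = direct_sum_inj_mem_norm[where X = X and NX = NX and \<gamma> = \<gamma>, OF X E]
  have diff: "s n - x \<in> X \<gamma>" for n
    using s x by (simp add: subspace_diff normed_on.subspace_carrier[OF X])
  have "limitin T (\<lambda>n. direct_sum_inj \<gamma> (s n)) (direct_sum_inj \<gamma> x) sequentially"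
    using inj s lim TX unfolding seq_continuous_map_def by blast
  then have "(\<lambda>n. ?N (direct_sum_inj \<gamma> (s n) - direct_sum_inj \<gamma> x)) \<longlonglongrightarrow> 0"
    using s x
    by (intro Kadets_Klee_tendsto[OF normed_on_direct_sum[OF X E] T KK]) (simp_all add: j)
  then have "(\<lambda>n. NX \<gamma> (s n - x) * ?c) \<longlonglongrightarrow> 0"
    by (simp add: direct_sum_inj_diff[symmetric] j(2)[OF diff])
  moreover have "?c \<noteq> 0"
    using banach_sequence_space.norm_unit_pos[OF E, of \<gamma>] by simp
  ultimately show "(\<lambda>n. NX \<gamma> (s n - x)) \<longlonglongrightarrow> 0"
    by (simp add: tendsto_mult_right_iff)
qed

lemma Kadets_Klee_sequence_space:
  assumes X: "\<And>\<gamma>. normed_on (X \<gamma>) (NX \<gamma>)" and E: "banach_sequence_space E NE"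
    and TE: "topspace TE = E"
    and u: "\<And>\<gamma>. u \<gamma> \<in> X \<gamma> \<and> NX \<gamma> (u \<gamma>) = 1"
    and inj: "seq_continuous_map TE T (seq_inj u)"
    and KK: "Kadets_Klee (direct_sum X NX E) (direct_sum_norm NX NE) T"
  shows "Kadets_Klee E NE TE"
  unfolding Kadets_Klee_def
proof (intro allI impI, elim conjE)
  fix s x
  assume s: "\<forall>n. s n \<in> E \<and> NE (s n) = 1" and x: "x \<in> E" "NE x = 1"
    and lim: "limitin TE s x sequentially"
  interpret E: banach_sequence_space E NE by fact
  let ?N = "direct_sum_norm NX NE"
  note j = seq_inj_mem_norm[where u = u, OF X E u]
  have diff: "s n - x \<in> E" for n
    using s x by (simp add: subspace_diff E.subspace_carrier)
  have "limitin T (\<lambda>n. seq_inj u (s n)) (seq_inj u x) sequentially"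
    using inj s lim TE unfolding seq_continuous_map_def by blast
  then have "(\<lambda>n. ?N (seq_inj u (s n) - seq_inj u x)) \<longlonglongrightarrow> 0"
    using KK s x j unfolding Kadets_Klee_def by simp
  then show "(\<lambda>n. NE (s n - x)) \<longlonglongrightarrow> 0"
    by (simp add: seq_inj_diff[symmetric] j(2)[OF diff])
qed

text \<open>
  A null sequence of \<open>X \<gamma>\<close>, cut off to the length \<open>r\<close> of the flat part of the norm in the coordinate
  \<open>\<gamma>\<close>, can be added to a fixed vector that vanishes at \<open>\<gamma>\<close> without changing its norm. The
  Kadets--Klee property therefore applies to these sums and shows that the cut-off sequence, and
  with it the original one, tends to zero in norm.
\<close>

lemma Schur_property_summand:
  assumes X: "\<And>\<gamma>. normed_on (X \<gamma>) (NX \<gamma>)" and E: "banach_sequence_space E NE"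
    and TX: "linear_topology_on (X \<gamma>) (TX \<gamma>)"
    and T: "linear_topology_on (direct_sum X NX E) T"
    and u: "\<And>\<gamma>. u \<gamma> \<in> X \<gamma> \<and> NX \<gamma> (u \<gamma>) = 1"
    and inj: "seq_continuous_map (TX \<gamma>) T (direct_sum_inj \<gamma>)"
    and KK: "Kadets_Klee (direct_sum X NX E) (direct_sum_norm NX NE) T"
    and not_SM: "\<not> SM E NE \<gamma>"
  shows "Schur_property (X \<gamma>) (NX \<gamma>) (TX \<gamma>)"
  unfolding Schur_property_def
proof (intro allI impI, elim conjE)
  fix s x
  assume s: "\<forall>n. s n \<in> X \<gamma>" and x: "x \<in> X \<gamma>" and lim: "limitin (TX \<gamma>) s x sequentially"
  interpret E: banach_sequence_space E NE by fact
  interpret X: normed_on "X \<delta>" "NX \<delta>" for \<delta> by (rule X)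
  let ?V = "direct_sum X NX E" and ?N = "direct_sum_norm NX NE" and ?c = "NE (indicator {\<gamma>})"
  interpret V: normed_on ?V ?N
    by (rule normed_on_direct_sum[OF X E])
  obtain a r where a: "a \<in> E" "\<And>\<delta>. 0 \<le> a \<delta>" "a \<gamma> = 0" and r: "0 < r"
    and flat: "\<And>t. 0 \<le> t \<Longrightarrow> t \<le> r \<Longrightarrow> a(\<gamma> := t) \<in> E \<and> NE (a(\<gamma> := t)) = NE a"
    using E.not_SM_imp_flat[OF not_SM] by blast
  have topX: "topspace (TX \<gamma>) = X \<gamma>"
    using TX by (simp add: linear_topology_on_def)
  define z where "z n = s n - x" for n
  have z: "z n \<in> X \<gamma>" for n
    using s x by (simp add: z_def subspace_diff X.subspace_carrier)
  have "limitin (TX \<gamma>) (\<lambda>n. s n + - x) (x + - x) sequentially"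
    using x by (intro linear_topology_limitin_add[OF TX lim] linear_topology_limitin_const[OF TX])
      (simp add: subspace_neg X.subspace_carrier)
  then have zlim: "limitin (TX \<gamma>) z 0 sequentially"
    by (simp add: z_def[abs_def])
  \<comment> \<open>These factors are at most one, which keeps the sequence null even where the norms of \<open>z\<close> are
    unbounded, and the norm of the shortened vector is \<open>min r\<close> of the old one, so that a small value
    of it reveals the norm of \<open>z n\<close> itself.\<close>
  define c where "c n = r / max r (NX \<gamma> (z n))" for n
  define w where "w n = c n *\<^sub>R z n" for n
  have c: "0 < c n" "c n \<le> 1" for n
    using r by (simp_all add: c_def)
  have w: "w n \<in> X \<gamma>" for n
    by (simp add: w_def z subspace_scale X.subspace_carrier)
  have Nw: "NX \<gamma> (w n) = min r (NX \<gamma> (z n))" for n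
    using r c[of n] X.norm_nonneg[OF z[of n]]
    by (auto simp: w_def X.norm_scaleR z c_def max_def min_def)
  have "limitin (TX \<gamma>) w 0 sequentially"
    unfolding w_def
    by (rule linear_topology_limitin_bounded_scaleR_zero[OF TX _ zlim, where K = 1])
      (use c in \<open>simp add: less_imp_le\<close>)
  then have "limitin T (\<lambda>n. direct_sum_inj \<gamma> (w n)) (direct_sum_inj \<gamma> 0) sequentially"
    using inj w topX unfolding seq_continuous_map_def by blast
  then have jlim: "limitin T (\<lambda>n. direct_sum_inj \<gamma> (w n)) 0 sequentially"
    by (simp add: direct_sum_inj_def zero_fun_def)
  define y where "y = seq_inj u a"
  define v where "v n = y + direct_sum_inj \<gamma> (w n)" for n
  have y: "y \<in> ?V" "?N y = NE a"
    using seq_inj_mem_norm[where u = u, OF X E u a(1)] by (simp_all add: y_def)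
  have j: "direct_sum_inj \<gamma> (w n) \<in> ?V" "?N (direct_sum_inj \<gamma> (w n)) = NX \<gamma> (w n) * ?c" for n
    using direct_sum_inj_mem_norm[where X = X and NX = NX and \<gamma> = \<gamma>, OF X E w] .
  have v: "v n \<in> ?V" for n
    by (simp add: v_def y j subspace_add V.subspace_carrier)
  have Nv: "?N (v n) = ?N y" for n
  proof -
    have "(\<lambda>\<delta>. NX \<delta> (v n \<delta>)) = a(\<gamma> := NX \<gamma> (w n))"
      using a u by (auto simp: fun_eq_iff v_def y_def seq_inj_def direct_sum_inj_def X.norm_scaleR)
    then show ?thesis
      using flat[of "NX \<gamma> (w n)"] X.norm_nonneg[OF w] y by (simp add: direct_sum_norm_def Nw)
  qed
  have "limitin T (\<lambda>n. y + direct_sum_inj \<gamma> (w n)) (y + 0) sequentially"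
    by (intro linear_topology_limitin_add[OF T _ jlim] linear_topology_limitin_const[OF T] y)
  then have vlim: "limitin T v y sequentially"
    by (simp add: v_def[abs_def])
  have "(\<lambda>n. ?N (v n - y)) \<longlonglongrightarrow> 0"
    by (rule Kadets_Klee_tendsto[OF V.normed_on_axioms T KK v y(1) vlim]) (simp add: Nv)
  then have "(\<lambda>n. NX \<gamma> (w n) * ?c) \<longlonglongrightarrow> 0"
    by (simp add: v_def j)
  then have wnull: "(\<lambda>n. NX \<gamma> (w n)) \<longlonglongrightarrow> 0"
    using E.norm_unit_pos[of \<gamma>] by (simp add: tendsto_mult_right_iff)
  have "\<forall>\<^sub>F n in sequentially. NX \<gamma> (w n) < r"
    using order_tendstoD(2)[OF wnull r] .
  then have "\<forall>\<^sub>F n in sequentially. NX \<gamma> (w n) = NX \<gamma> (s n - x)"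
    by eventually_elim (simp add: Nw z_def min_def split: if_splits)
  then show "(\<lambda>n. NX \<gamma> (s n - x)) \<longlonglongrightarrow> 0"
    by (rule Lim_transform_eventually[OF wnull])
qed

section \<open>Inheritance and decomposition\<close>

theorem theorem1:
  fixes X :: "'g::countable \<Rightarrow> 'v::real_vector set"
    and NX :: "'g \<Rightarrow> 'v \<Rightarrow> real"
    and TX :: "'g \<Rightarrow> 'v topology"
    and E :: "('g \<Rightarrow> real) set"
    and NE :: "('g \<Rightarrow> real) \<Rightarrow> real"
    and TE :: "('g \<Rightarrow> real) topology"
    and u :: "'g \<Rightarrow> 'v"
    and T :: "('g \<Rightarrow> 'v) topology"
  assumes "\<And>\<gamma>. banach_on (X \<gamma>) (NX \<gamma>)"
    and "\<And>\<gamma>. infinite_dimensional (X \<gamma>)"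
    and "\<And>\<gamma>. linear_topology_on (X \<gamma>) (TX \<gamma>)"
    and "\<And>\<gamma>. Hausdorff_space (TX \<gamma>)"
    and "\<And>\<gamma>. coarser_topology (TX \<gamma>) (norm_topology (X \<gamma>) (NX \<gamma>))"
    and "banach_sequence_space E NE"
    and "linear_topology_on E TE"
    and "Hausdorff_space TE"
    and "coarser_topology TE (norm_topology E NE)"
    and "\<And>\<gamma>. u \<gamma> \<in> X \<gamma> \<and> NX \<gamma> (u \<gamma>) = 1"
    and "direct_sum_compatible X NX TX E NE TE u T"
    and "Kadets_Klee (direct_sum X NX E) (direct_sum_norm NX NE) T"
  shows "(\<forall>\<gamma>. Kadets_Klee (X \<gamma>) (NX \<gamma>) (TX \<gamma>)) \<and> Kadets_Klee E NE TE \<and>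
    (\<exists>\<Gamma>1 \<Gamma>2. \<Gamma>1 \<union> \<Gamma>2 = UNIV \<and> \<Gamma>1 \<inter> \<Gamma>2 = {} \<and>
      (\<forall>\<gamma>\<in>\<Gamma>1. Schur_property (X \<gamma>) (NX \<gamma>) (TX \<gamma>)) \<and> (\<forall>\<gamma>\<in>\<Gamma>2. SM E NE \<gamma>))"
proof -
  have X: "\<And>\<gamma>. normed_on (X \<gamma>) (NX \<gamma>)"
    using assms(1) by (simp add: banach_on_def)
  have T: "linear_topology_on (direct_sum X NX E) T"
    and inj: "\<And>\<gamma>. seq_continuous_map (TX \<gamma>) T (direct_sum_inj \<gamma>)"
    and seq_inj: "seq_continuous_map TE T (seq_inj u)"
    using assms(11) by (auto simp: direct_sum_compatible_def)
  have topX: "\<And>\<gamma>. topspace (TX \<gamma>) = X \<gamma>" and topE: "topspace TE = E"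
    using assms(3,7) by (simp_all add: linear_topology_on_def)
  have "Kadets_Klee (X \<gamma>) (NX \<gamma>) (TX \<gamma>)" for \<gamma>
    by (rule Kadets_Klee_summand[where X = X and NX = NX and TX = TX,
          OF X assms(6) topX T inj assms(12)])
  moreover have "Kadets_Klee E NE TE"
    by (rule Kadets_Klee_sequence_space[where X = X and NX = NX and u = u,
          OF X assms(6) topE assms(10) seq_inj assms(12)])
  moreover have "Schur_property (X \<gamma>) (NX \<gamma>) (TX \<gamma>)" if "\<not> SM E NE \<gamma>" for \<gamma>
    by (rule Schur_property_summand[where X = X and NX = NX and TX = TX and u = u,
          OF X assms(6,3) T assms(10) inj assms(12) that])
  ultimately show ?thesis
    by (intro conjI exI[of _ "{\<gamma>. \<not> SM E NE \<gamma>}"] exI[of _ "{\<gamma>. SM E NE \<gamma>}"]) auto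
qed

end
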